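(* Let $A=\mathbb{F}_q[t]$, where $q$ is a power of an odd prime $p$. Let $\wp\in A$ be a monic irreducible polynomial of degree $d$, and let $\theta\in\mathbb{F}_{q^d}$ be a root of $\wp$. The following conditions are equivalent: (0) $\wp$ is a Wilson prime, i.e. $F_d\equiv -1\pmod{\wp^2}$; (i) $d^2\wp/dt^2=0$; (i') $d^2\wp/dt^2\equiv 0\pmod{\wp}$; (i'') $(d^2\wp/dt^2)|_{t=\theta}=0$; (ii) $Q_{\wp}^2(t)\equiv 0\pmod{\wp}$; (ii') $Q_{\wp}^2(t)|_{t=\theta}=0$; (iii) $\wp^{[2]}|_{t=\theta}=0$.
   Context: $F_d$ denotes the product of all nonzero polynomials in $A$ of degree less than $d$. For $a\in\mathbb{F}_{q^d}[t]$, the Fermat quotient is $Q_{\wp}(a):=(a^{q^d}-a)/\wp\in\mathbb{F}_{q^d}[t]$, and $Q_{\wp}^2(t):=Q_{\wp}(Q_{\wp}(t))$. The difference quotients are defined by $a^{[0]}=a$ and $a^{[i+1]}(t)=(a^{[i]}(t)-a^{[i]}(\theta))/(t-\theta)$; so $\wp^{[2]}=(\wp^{[1]}(t)-\wp^{[1]}(\theta))/(t-\theta)$ with $\wp^{[1]}(t)=(\wp(t)-\wp(\theta))/(t-\theta)$. Congruences modulo $\wp$ are divisibility in $\mathbb{F}_{q^d}[t]$. *)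

theory Defs
  imports "HOL-Library.Cardinality" "HOL-Number_Theory.Cong" "Subresultants.More_Homomorphisms"
begin

definition F_prod :: "nat \<Rightarrow> 'a::finite_field poly" where
  "F_prod d = \<Prod>{f. f \<noteq> 0 \<and> degree f < d}"

(* With P the image in F_{q^d}[t] of a prime of F_q[t] of degree d, the power is q^d = |F_{q^d}| and
   the division is exact: a^(q^d) - a = a(t^(q^d)) - a(t) is a multiple of t^(q^d) - t,
   which P divides. *)
definition fermat_quotient :: "nat \<Rightarrow> 'b::field poly \<Rightarrow> 'b poly \<Rightarrow> 'b poly" where
  "fermat_quotient q P a = (a ^ (q ^ degree P) - a) div P"

(* diff_quotient x a i is a^[i]; the division by t - x is exact since the numerator vanishes at x. *)
primrec diff_quotient :: "'b::field \<Rightarrow> 'b poly \<Rightarrow> nat \<Rightarrow> 'b poly" where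
  "diff_quotient x a 0 = a"
| "diff_quotient x a (Suc i) =
     (diff_quotient x a i - [:poly (diff_quotient x a i) x:]) div [:- x, 1:]"

end

(* Every condition is reduced to the vanishing of P'' at theta.

   Fermat quotients: put U = Q(t) and R = Q(U). Since q-th powers have derivative 0, differentiating
   P U = t^(q^d) - t twice and P R = U^(q^d) - U once and evaluating at theta gives P' U = -1,
   P'' U + 2 P' U' = 0 and P' R = -U', whence R = 0 iff P'' = 0 at theta.

   Wilson primes: f |-> f(theta) maps the nonzero f of degree < d bijectively onto the nonzero
   elements of the residue field, so F_d(theta) = -1 and F_d'(theta) = -(sum of f'(theta) / f(theta)).
   The last sum is G'(theta) for G = sum of f(theta)^(-1) f. Power sums over the residue field show
   that G is -1 at theta and 0 at its other conjugates, so (t - theta) G is a nonzero constant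
   multiple of P; differentiating twice makes 2 G'(theta) the same multiple of P''(theta). *)

theory Submission
  imports Defs
begin

section \<open>Finite fields\<close>

lemma finite_field_power_card_minus_1:
  fixes x :: "'a::finite_field"
  assumes "x \<noteq> 0"
  shows "x ^ (CARD('a) - 1) = 1"
proof -
  have "x * x ^ (CARD('a) - 1) = x"
    using finite_field_power_card_eq_same[of x]
    by (metis power_Suc Suc_diff_1 zero_less_card_finite)
  with assms show ?thesis by simp
qed

text \<open>Translation by 1 permutes the ring, yet it changes the sum of all elements by
  \<open>CARD('a)\<close> times 1.\<close>

lemma of_nat_card_finite_ring: "of_nat CARD('a) = (0 :: 'a::{finite, ring_1})"
proof -
  have "(\<Sum>x\<in>UNIV. x + 1) = (\<Sum>x\<in>UNIV. x :: 'a)"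
    by (rule sum.reindex_bij_witness[of _ "\<lambda>x. x - 1" "\<lambda>x. x + 1"]) auto
  thus ?thesis by (simp add: sum.distrib)
qed

lemma CHAR_eq_if_card_prime_power:
  assumes "prime p" and "CARD('a::finite_field) = p ^ n"
  shows "CHAR('a) = p"
proof -
  have "CHAR('a) dvd p ^ n"
    using of_nat_card_finite_ring[where 'a = 'a] assms(2)
    by (simp add: of_nat_eq_0_iff_char_dvd del: of_nat_power)
  hence "CHAR('a) dvd p"
    using prime_dvd_power[OF CHAR_prime] by blast
  thus ?thesis
    using assms(1) by (simp add: primes_dvd_imp_eq)
qed

lemma card_finite_field_gt_1: "CARD('a::finite_field) > 1"
proof -
  have "card {0, 1::'a} \<le> CARD('a)" by (intro card_mono) auto
  thus ?thesis by simp
qed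

text \<open>Scaling by a nonzero \<open>y\<close> permutes the summation range and multiplies the
  sum by \<open>y ^ m\<close>. If the sum were nonzero, every nonzero \<open>y\<close> would be a
  root of t^m - 1, too many for its degree.\<close>

lemma finite_field_power_sum_eq_0:
  fixes m :: nat
  assumes "0 < m" and "m < CARD('a) - 1"
  shows "(\<Sum>x\<in>UNIV - {0::'a::finite_field}. x ^ m) = 0"
proof (rule ccontr)
  let ?S = "\<Sum>x\<in>UNIV - {0::'a}. x ^ m"
  assume nz: "?S \<noteq> 0"
  have "y ^ m = 1" if "y \<noteq> 0" for y :: 'a
  proof -
    have "y ^ m * ?S = (\<Sum>x\<in>UNIV - {0}. (y * x) ^ m)"
      by (simp add: sum_distrib_left power_mult_distrib)
    also have "\<dots> = ?S"
      by (rule sum.reindex_bij_witness[of _ "\<lambda>x. x / y" "\<lambda>x. y * x"]) (use that in auto)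
    finally show ?thesis using nz by simp
  qed
  hence sub: "UNIV - {0} \<subseteq> {x::'a. poly (monom 1 m - 1) x = 0}"
    by (auto simp: poly_monom)
  have "coeff (monom 1 m - 1 :: 'a poly) m = 1"
    using assms(1) by simp
  hence ne: "monom 1 m - 1 \<noteq> (0 :: 'a poly)" by force
  have "CARD('a) - 1 \<le> card {x::'a. poly (monom 1 m - 1) x = 0}"
    using card_mono[OF _ sub] by (simp add: card_Diff_singleton)
  also have "\<dots> \<le> degree (monom 1 m - 1 :: 'a poly)"
    by (rule card_poly_roots_bound[OF ne])
  also have "\<dots> \<le> m"
    by (intro degree_diff_le) (auto simp: degree_monom_le)
  finally show False using assms(2) by simp
qed

text \<open>Wilson's theorem for finite fields: with N = \<open>CARD('a) - 1\<close>, the product of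
  all t - x for nonzero x is t^N - 1, and the constant terms are compared. As N is even, the signs
  cancel.\<close>

lemma finite_field_prod_nonzero:
  assumes "odd CARD('a::finite_field)"
  shows "\<Prod>(UNIV - {0::'a}) = -1"
proof -
  let ?N = "CARD('a) - 1"
  let ?f = "\<Prod>x\<in>UNIV - {0::'a}. [:- x, 1:]"
  have N: "?N > 0" using card_finite_field_gt_1[where 'a = 'a] by simp
  have card: "card (UNIV - {0::'a}) = ?N" by (simp add: card_Diff_singleton)
  have deg: "degree ?f = ?N"
    by (subst degree_prod_eq_sum_degree) (auto simp: card)
  have "lead_coeff ?f = 1" by (simp add: lead_coeff_prod)
  hence "?f = monom 1 ?N - 1"
    using N card deg finite_field_power_card_minus_1[where 'a = 'a]
    by (intro poly_eqI_degree_lead_coeff[where n = ?N and A = "UNIV - {0}"])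
       (auto simp: degree_monom_le poly_monom poly_prod intro!: degree_diff_le)
  hence "poly ?f 0 = -1" using N by (simp add: poly_monom)
  moreover have "poly ?f 0 = (\<Prod>x\<in>UNIV - {0::'a}. - x)"
    by (simp add: poly_prod)
  moreover have "\<dots> = \<Prod>(UNIV - {0})"
    using assms by (simp add: prod_uminus card)
  ultimately show ?thesis by simp
qed

text \<open>Coefficient lists of length \<open>d\<close> parametrize these polynomials. The disjunct
  \<open>f = 0\<close> keeps this correct for \<open>d = 0\<close>, where the empty list gives
  0.\<close>

lemma card_poly_degree_less: "CARD('a) ^ d \<le> card {f :: 'a::finite_field poly. f = 0 \<or> degree f < d}"
  and finite_poly_degree_less: "finite {f :: 'a::finite_field poly. f = 0 \<or> degree f < d}"
proof -
  let ?L = "{xs :: 'a list. set xs \<subseteq> UNIV \<and> length xs = d}"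
  have eq: "{f :: 'a poly. f = 0 \<or> degree f < d} = Poly ` ?L"
  proof (intro equalityI subsetI)
    fix f :: "'a poly" assume "f \<in> {f. f = 0 \<or> degree f < d}"
    hence *: "coeff f i = 0" if "i \<ge> d" for i using that by (auto intro: coeff_eq_0)
    have "f = Poly (map (coeff f) [0..<d])"
      by (intro poly_eqI) (auto simp: coeff_Poly nth_default_def *)
    thus "f \<in> Poly ` ?L" by auto
  next
    fix f :: "'a poly" assume "f \<in> Poly ` ?L"
    then obtain xs where xs: "f = Poly xs" "length xs = d" by auto
    have "coeff f i = 0" if "i \<ge> d" for i using that xs by (simp add: coeff_Poly nth_default_def)
    thus "f \<in> {f. f = 0 \<or> degree f < d}"
      by (metis (mono_tags, lifting) leading_coeff_0_iff linorder_not_le mem_Collect_eq)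
  qed
  have "inj_on Poly ?L"
  proof (rule inj_onI)
    fix xs ys :: "'a list"
    assume *: "xs \<in> ?L" "ys \<in> ?L" "Poly xs = Poly ys"
    hence len: "length xs = d" "length ys = d" by auto
    show "xs = ys"
    proof (rule nth_equalityI)
      fix i assume "i < length xs"
      thus "xs ! i = ys ! i"
        using arg_cong[OF *(3), of "\<lambda>f. coeff f i"] len by (simp add: coeff_Poly nth_default_def)
    qed (simp add: len)
  qed
  moreover have "card ?L = CARD('a) ^ d" and "finite ?L"
    using card_lists_length_eq[of "UNIV :: 'a set" d] finite_lists_length_eq[of "UNIV :: 'a set" d]
    by auto
  ultimately show "CARD('a) ^ d \<le> card {f :: 'a poly. f = 0 \<or> degree f < d}"
    and "finite {f :: 'a poly. f = 0 \<or> degree f < d}"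
    unfolding eq by (simp_all add: card_image)
qed

section \<open>Polynomials\<close>

lemma diff_quotient_Suc:
  "diff_quotient x a i = [:poly (diff_quotient x a i) x:] + [:- x, 1:] * diff_quotient x a (Suc i)"
proof -
  have "[:- x, 1:] dvd diff_quotient x a i - [:poly (diff_quotient x a i) x:]"
    unfolding poly_eq_0_iff_dvd[symmetric] by simp
  thus ?thesis by (simp del: mult_pCons_left)
qed

text \<open>Two exact divisions give the Taylor expansion a = c0 + c1 (t - x) + b (t - x)^2, where b
  is the second difference quotient.\<close>

lemma poly_pderiv2_eq_diff_quotient:
  "poly (pderiv (pderiv a)) x = 2 * poly (diff_quotient x a 2) x"
proof -
  define b where "b = diff_quotient x a 2"
  obtain c0 c1 where a: "a = [:c0:] + [:- x, 1:] * ([:c1:] + [:- x, 1:] * b)"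
    using diff_quotient_Suc[of x a 0] diff_quotient_Suc[of x a 1]
    by (metis b_def diff_quotient.simps(1) One_nat_def Suc_1)
  have "poly (pderiv (pderiv a)) x = 2 * poly b x"
    by (subst a) (simp add: pderiv_mult pderiv_add pderiv_pCons del: mult_pCons_left)
  thus ?thesis by (simp add: b_def)
qed

section \<open>The residue field of a prime\<close>

text \<open>Since \<open>d\<close> is both the degree of \<open>P\<close> and the degree of
  \<open>'b\<close> over the image of \<open>'a\<close>, the field \<open>'b\<close> is the residue
  field of \<open>P\<close>.\<close>

locale residue_field_embedding = field_hom \<iota>
  for \<iota> :: "'a::finite_field \<Rightarrow> 'b::finite_field" +
  fixes P :: "'a poly" and \<theta> :: 'b and p q d n :: nat
  assumes prime_p: "prime p" and odd_p: "odd p" and q_def: "q = p ^ n"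
    and card_a: "CARD('a) = q" and card_b: "CARD('b) = q ^ d"
    and irred: "irreducible P" and monic: "lead_coeff P = 1" and deg_P: "degree P = d"
    and root: "poly (map_poly \<iota> P) \<theta> = 0"
begin

sublocale mp: map_poly_inj_idom_hom \<iota> ..

text \<open>This is reduction modulo \<open>P\<close>, with values in the residue field.\<close>

definition ev :: "'a poly \<Rightarrow> 'b" where
  "ev f = poly (map_poly \<iota> f) \<theta>"

sublocale ev: idom_hom ev
  by unfold_locales (simp_all add: ev_def hom_distribs)

lemma d_pos: "d > 0"
  using irred deg_P by (metis irreducible_def is_unit_iff_degree neq0_conv)

lemma q_gt_1: "q > 1"
  using card_finite_field_gt_1[where 'a = 'a] card_a by simp

lemma odd_q: "odd q"
  using odd_p q_def by simp

lemma CHAR_b: "CHAR('b) = p"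
  by (rule CHAR_eq_if_card_prime_power[OF prime_p, of "n * d"])
     (simp add: card_b q_def power_mult)

lemma two_neq_0: "(2 :: 'b) \<noteq> 0"
proof
  assume "(2 :: 'b) = 0"
  hence "CHAR('b) dvd 2"
    using of_nat_eq_0_iff_char_dvd[of 2, where 'a = 'b] by simp
  thus False
    using prime_p odd_p by (metis CHAR_b primes_dvd_imp_eq two_is_prime_nat even_numeral dvd_refl)
qed

text \<open>A nonzero kernel element \<open>g\<close> of least degree divides the whole kernel, in
  particular \<open>P\<close>. It is not a unit, so irreducibility makes \<open>P\<close> divide
  \<open>g\<close> in turn.\<close>

lemma ev_eq_0_iff: "ev f = 0 \<longleftrightarrow> P dvd f"
proof
  assume f: "ev f = 0"
  have "P \<noteq> 0 \<and> ev P = 0" using irred root by (auto simp: ev_def)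
  then obtain g where g: "g \<noteq> 0" "ev g = 0"
    and min: "\<And>h. h \<noteq> 0 \<Longrightarrow> ev h = 0 \<Longrightarrow> degree g \<le> degree h"
    using ex_has_least_nat[of "\<lambda>g. g \<noteq> 0 \<and> ev g = 0" P degree] by blast
  have g_dvd: "g dvd h" if "ev h = 0" for h
  proof (rule ccontr)
    assume "\<not> g dvd h"
    hence "h mod g \<noteq> 0" by (simp add: mod_eq_0_iff_dvd)
    moreover have "ev (h mod g) = 0"
      using that g by (simp add: minus_div_mult_eq_mod[symmetric] ev.hom_minus ev.hom_mult)
    ultimately show False
      using min[of "h mod g"] degree_mod_less[OF g(1), of h] by auto
  qed
  obtain h where h: "P = g * h"
    using g_dvd[of P] root unfolding ev_def by (blast elim: dvdE)
  have "\<not> g dvd 1" using g(2) ev.hom_dvd[of g 1] by auto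
  hence "h dvd 1" using irreducibleD[OF irred h] by blast
  hence "P dvd g" by (simp add: h mult_unit_dvd_iff)
  thus "P dvd f" using g_dvd[OF f] by (rule dvd_trans)
next
  assume "P dvd f"
  thus "ev f = 0" using root by (auto simp: ev_def[of P] ev.hom_mult elim!: dvdE)
qed

text \<open>Powers with exponent \<open>q ^ j\<close> are additive and fix the image of \<iota>. In
  particular every \<open>\<theta> ^ (q ^ j)\<close> is a root of \<open>P\<close>.\<close>

lemma poly_map_frobenius: "poly (map_poly \<iota> f) (\<theta> ^ (q ^ j)) = ev f ^ (q ^ j)"
proof (induction f)
  case 0
  have "q ^ j > 0" using q_gt_1 by simp
  thus ?case by (simp add: ev_def power_0_left)
next
  case (pCons c f)
  have c: "\<iota> c ^ (q ^ j) = \<iota> c"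
    using finite_field_power_card_power_eq_same[of "q ^ j" j c] by (simp add: card_a flip: hom_power)
  have "ev (pCons c f) ^ (q ^ j) = (\<iota> c + \<theta> * ev f) ^ (q ^ j)"
    by (simp add: ev_def hom_distribs)
  also have "\<dots> = \<iota> c ^ (q ^ j) + (\<theta> * ev f) ^ (q ^ j)"
    by (rule freshmans_dream'[where n = "n * j"]) (simp_all add: CHAR_b prime_p q_def power_mult)
  finally show ?case
    by (simp add: hom_distribs c power_mult_distrib pCons.IH)
qed

subsection \<open>Fermat quotients\<close>

lemma pderiv_power_q_pow_d: "pderiv (f ^ (q ^ d)) = (0 :: 'a poly)"
proof -
  have "of_nat q = (0 :: 'a)" using of_nat_card_finite_ring[where 'a = 'a] card_a by simp
  thus ?thesis using d_pos by (simp add: pderiv_power power_0_left)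
qed

lemma P_dvd_power_minus: "P dvd f ^ (q ^ d) - f"
proof -
  have "ev (f ^ (q ^ d) - f) = 0"
    using finite_field_power_card_eq_same[of "ev f"]
    by (simp add: ev.hom_minus ev.hom_power card_b)
  thus ?thesis by (simp add: ev_eq_0_iff)
qed

lemma P_mult_fermat_quotient: "P * fermat_quotient q P f = f ^ (q ^ d) - f"
  using P_dvd_power_minus by (simp add: fermat_quotient_def deg_P)

lemma fermat_quotient_map_poly:
  "fermat_quotient q (map_poly \<iota> P) (map_poly \<iota> f) = map_poly \<iota> (fermat_quotient q P f)"
  by (simp add: fermat_quotient_def map_poly_div mp.hom_minus mp.hom_power)

lemma ev_pderiv_mult_fermat_quotient:
  "ev (pderiv P) * ev (fermat_quotient q P f) = - ev (pderiv f)"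
proof -
  have "pderiv (P * fermat_quotient q P f) = - pderiv f"
    by (simp add: P_mult_fermat_quotient pderiv_diff pderiv_power_q_pow_d)
  hence "ev (pderiv (P * fermat_quotient q P f)) = ev (- pderiv f)" by simp
  thus ?thesis using root
    by (simp add: pderiv_mult ev.hom_add ev.hom_mult ev.hom_uminus ev_def[of P] mult.commute)
qed

text \<open>For f = t the preceding identity has right-hand side -1; hence \<theta> is a simple root
  of \<open>P\<close>.\<close>

lemma ev_pderiv_P_neq_0: "ev (pderiv P) \<noteq> 0"
  using ev_pderiv_mult_fermat_quotient[of "[:0, 1:]"] by (auto simp: pderiv_pCons)

lemma ev_fermat_quotient_twice_eq_0_iff:
  "ev (fermat_quotient q P (fermat_quotient q P [:0, 1:])) = 0 \<longleftrightarrow> ev (pderiv (pderiv P)) = 0"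
proof -
  define U where "U = fermat_quotient q P [:0, 1:]"
  have "pderiv (P * U) = - [:1:]"
    by (simp add: U_def P_mult_fermat_quotient pderiv_diff pderiv_power_q_pow_d pderiv_pCons)
  hence "pderiv (pderiv (P * U)) = 0" by (simp add: pderiv_minus)
  hence "ev (pderiv (pderiv (P * U))) = 0" by simp
  hence U2: "ev (pderiv (pderiv P)) * ev U + 2 * ev (pderiv P) * ev (pderiv U) = 0"
    using root
    by (simp add: pderiv_mult pderiv_add ev.hom_add ev.hom_mult ev.hom_numeral ev_def[of P] algebra_simps)
  have "ev (pderiv P) * ev U = -1"
    using ev_pderiv_mult_fermat_quotient[of "[:0, 1:]"] by (simp add: U_def pderiv_pCons)
  hence "ev U \<noteq> 0" by auto
  \<comment> \<open>In \<open>U2\<close> the coefficients \<open>ev U\<close> and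
    \<open>2 * ev (pderiv P)\<close> are both nonzero, the latter because the characteristic is
    odd.\<close>
  hence "ev (pderiv (pderiv P)) = 0 \<longleftrightarrow> ev (pderiv U) = 0"
    using U2 ev_pderiv_P_neq_0 two_neq_0 by (auto simp: add_eq_0_iff)
  also have "\<dots> \<longleftrightarrow> ev (fermat_quotient q P U) = 0"
    using ev_pderiv_mult_fermat_quotient[of U] ev_pderiv_P_neq_0 by auto
  finally show ?thesis by (simp add: U_def)
qed

subsection \<open>Wilson primes\<close>

text \<open>If f = P g, then f'(\<theta>) = P'(\<theta>) g(\<theta>) with P'(\<theta>) nonzero, so
  f'(\<theta>) detects a second factor \<open>P\<close>.\<close>

lemma P_square_dvd_iff: "P ^ 2 dvd f \<longleftrightarrow> ev f = 0 \<and> ev (pderiv f) = 0"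
proof (cases "ev f = 0")
  case True
  then obtain g where g: "f = P * g" unfolding ev_eq_0_iff by (rule dvdE)
  have "P \<noteq> 0" using irred by auto
  hence "P ^ 2 dvd f \<longleftrightarrow> P dvd g" by (simp add: g power2_eq_square)
  also have "\<dots> \<longleftrightarrow> ev (pderiv f) = 0"
    using root ev_pderiv_P_neq_0
    by (simp add: g pderiv_mult ev.hom_add ev.hom_mult ev_def[of P] flip: ev_eq_0_iff)
  finally show ?thesis using True by simp
next
  case False
  thus ?thesis by (metis dvd_trans dvd_triv_left ev_eq_0_iff power2_eq_square)
qed

text \<open>Two polynomials with equal values differ by a multiple of \<open>P\<close> of degree
  below \<open>d\<close>, which is 0. Counting \<open>q ^ d\<close> of them gives
  surjectivity.\<close>

lemma bij_betw_ev: "bij_betw ev {f. f \<noteq> 0 \<and> degree f < d} (UNIV - {0})"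
proof -
  let ?S = "{f :: 'a poly. f = 0 \<or> degree f < d}"
  have inj: "inj_on ev ?S"
  proof (rule inj_onI)
    fix f g assume *: "f \<in> ?S" "g \<in> ?S" "ev f = ev g"
    hence "P dvd f - g" by (simp add: ev.hom_minus flip: ev_eq_0_iff)
    moreover have "degree (f - g) < d"
      using * d_pos by (intro degree_diff_less) auto
    ultimately show "f = g"
      using dvd_imp_degree_le deg_P by (metis eq_iff_diff_eq_0 linorder_not_less)
  qed
  have "card (ev ` ?S) \<ge> CARD('b)"
    using card_poly_degree_less[of d, where 'a = 'a] by (simp add: card_image inj card_a card_b)
  hence "ev ` ?S = UNIV"
    by (intro card_seteq) auto
  hence "bij_betw ev ?S UNIV" using inj by (simp add: bij_betw_def)
  hence "bij_betw ev (?S - {0}) (UNIV - {ev 0})"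
    by (intro bij_betw_DiffI) auto
  moreover have "?S - {0} = {f. f \<noteq> 0 \<and> degree f < d}" by auto
  ultimately show ?thesis by simp
qed

lemma ev_F_prod: "ev (F_prod d) = -1"
proof -
  have "ev (F_prod d) = (\<Prod>f\<in>{f. f \<noteq> 0 \<and> degree f < d}. ev f)"
    by (simp add: F_prod_def ev.hom_prod)
  also have "\<dots> = \<Prod>(UNIV - {0})"
    by (rule prod.reindex_bij_betw[OF bij_betw_ev])
  also have "\<dots> = -1"
    using odd_q by (intro finite_field_prod_nonzero) (simp add: card_b)
  finally show ?thesis .
qed

section \<open>Conjugates of \<theta> and interpolation\<close>

lemma inj_on_conjugates: "inj_on (\<lambda>j. \<theta> ^ (q ^ j)) {..<d}"
proof (rule linorder_inj_onI')
  fix i j assume ij: "i \<in> {..<d}" "j \<in> {..<d}" "i < j"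
  show "\<theta> ^ (q ^ i) \<noteq> \<theta> ^ (q ^ j)"
  proof
    assume eq: "\<theta> ^ (q ^ i) = \<theta> ^ (q ^ j)"
    \<comment> \<open>Raising both sides to the power \<open>q ^ (d - j)\<close> turns the right one
      into \<theta> and the left one into \<open>\<theta> ^ (q ^ k)\<close>, with 0 < k < d.\<close>
    define k where "k = i + (d - j)"
    have "\<theta> ^ (q ^ k) = (\<theta> ^ (q ^ i)) ^ (q ^ (d - j))"
      by (simp add: k_def power_add power_mult)
    also have "\<dots> = \<theta> ^ (q ^ d)"
      unfolding eq using ij by (simp flip: power_mult power_add)
    finally have k: "\<theta> ^ (q ^ k) = \<theta>"
      using finite_field_power_card_eq_same[of \<theta>] card_b by simp
    \<comment> \<open>Each x is a value f(\<theta>), so it is fixed along with \<theta>. The power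
      sum with exponent \<open>q ^ k - 1\<close> then counts the nonzero elements, giving -1 instead
      of 0.\<close>
    have "x ^ (q ^ k - 1) = 1" if "x \<in> UNIV - {0}" for x :: 'b
    proof -
      from that have "x \<in> ev ` {f. f \<noteq> 0 \<and> degree f < d}"
        using bij_betw_imp_surj_on[OF bij_betw_ev] by simp
      then obtain f where f: "x = ev f" by blast
      have "x ^ (q ^ k) = x"
        using poly_map_frobenius[of f k] by (simp add: k f ev_def)
      moreover have "x ^ (q ^ k) = x * x ^ (q ^ k - 1)"
        using q_gt_1 by (simp flip: power_Suc)
      ultimately show ?thesis using that by simp
    qed
    hence "(\<Sum>x\<in>UNIV - {0::'b}. x ^ (q ^ k - 1)) = of_nat (CARD('b) - 1)"
      by (simp add: card_Diff_singleton)
    moreover have "of_nat (CARD('b) - 1) = (-1 :: 'b)"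
      by (simp add: of_nat_diff of_nat_card_finite_ring Suc_leI)
    moreover have "(\<Sum>x\<in>UNIV - {0::'b}. x ^ (q ^ k - 1)) = 0"
    proof (rule finite_field_power_sum_eq_0)
      have "k < d" "k > 0" using ij by (auto simp: k_def)
      thus "q ^ k - 1 < CARD('b) - 1" "0 < q ^ k - 1"
        using q_gt_1 one_less_power[of q k] by (auto simp: card_b intro!: diff_less_mono)
    qed
    ultimately show False by simp
  qed
qed

text \<open>Up to a constant, \<open>P / (t - \<theta>)\<close> is obtained by Lagrange interpolation, since the power sums
  of \<open>'b\<close> make the sum below vanish at all conjugates of \<open>\<theta>\<close> but \<open>\<theta>\<close> itself.\<close>

definition G :: "'b poly" where
  "G = (\<Sum>f\<in>{f. f \<noteq> 0 \<and> degree f < d}. Polynomial.smult (ev f ^ (q ^ d - 2)) (map_poly \<iota> f))"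

text \<open>By Frobenius the value is a power sum over the nonzero elements, whose exponent reduces
  modulo \<open>q ^ d - 1\<close> to \<open>q ^ j - 1\<close>. For \<open>j = 0\<close> it counts
  these elements.\<close>

lemma poly_G_conjugate:
  assumes "j < d"
  shows "poly G (\<theta> ^ (q ^ j)) = (if j = 0 then -1 else 0)"
proof -
  have qd: "q ^ d \<ge> 2"
    using card_finite_field_gt_1[where 'a = 'b] card_b by simp
  have "poly G (\<theta> ^ (q ^ j))
      = (\<Sum>f\<in>{f. f \<noteq> 0 \<and> degree f < d}. ev f ^ (q ^ d - 2) * ev f ^ (q ^ j))"
    by (simp add: G_def poly_sum poly_map_frobenius)
  also have "\<dots> = (\<Sum>x\<in>UNIV - {0}. x ^ (q ^ d - 2) * x ^ (q ^ j))"
    by (rule sum.reindex_bij_betw[OF bij_betw_ev])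
  also have "\<dots> = (\<Sum>x\<in>UNIV - {0::'b}. x ^ (q ^ j - 1))"
  proof (rule sum.cong)
    fix x :: 'b assume x: "x \<in> UNIV - {0}"
    have "q ^ d - 2 + q ^ j = (q ^ d - 1) + (q ^ j - 1)"
      using qd q_gt_1 by (simp add: Suc_leI)
    thus "x ^ (q ^ d - 2) * x ^ (q ^ j) = x ^ (q ^ j - 1)"
      using x finite_field_power_card_minus_1[of x]
      by (simp add: card_b flip: power_add) (simp add: power_add)
  qed simp
  also have "\<dots> = (if j = 0 then -1 else 0)"
  proof (cases "j = 0")
    case True
    thus ?thesis
      by (simp add: card_Diff_singleton of_nat_diff of_nat_card_finite_ring Suc_leI)
  next
    case False
    hence "0 < q ^ j - 1" "q ^ j - 1 < CARD('b) - 1"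
      using assms q_gt_1 one_less_power[of q j] by (auto simp: card_b intro!: diff_less_mono)
    thus ?thesis using False by (simp add: finite_field_power_sum_eq_0)
  qed
  finally show ?thesis .
qed

text \<open>Both sides have degree at most \<open>d\<close>, equal coefficients at t^d because
  \<open>P\<close> is monic, and \<open>d\<close> common roots, the conjugates of \<theta>.\<close>

lemma G_mult: "\<exists>c. [:- \<theta>, 1:] * G = Polynomial.smult c (map_poly \<iota> P)"
proof
  let ?c = "coeff ([:- \<theta>, 1:] * G) d"
  let ?A = "(\<lambda>j. \<theta> ^ (q ^ j)) ` {..<d}"
  have "degree G \<le> d - 1" unfolding G_def
    by (intro degree_sum_le finite_subset[OF _ finite_poly_degree_less[of d]])
       (auto intro!: order.trans[OF degree_smult_le])
  hence deg: "degree ([:- \<theta>, 1:] * G) \<le> d"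
    using degree_mult_le[of "[:- \<theta>, 1:]" G] d_pos by simp
  show "[:- \<theta>, 1:] * G = Polynomial.smult ?c (map_poly \<iota> P)"
  proof (rule poly_eqI_degree_lead_coeff[where n = d and A = ?A])
    show "coeff ([:- \<theta>, 1:] * G) d = coeff (Polynomial.smult ?c (map_poly \<iota> P)) d"
      using monic deg_P by (simp del: mult_pCons_left)
    show "card ?A \<ge> d" by (simp add: card_image inj_on_conjugates)
    show "degree (Polynomial.smult ?c (map_poly \<iota> P)) \<le> d"
      using degree_smult_le[of ?c "map_poly \<iota> P"] by (simp add: deg_P)
    fix z assume "z \<in> ?A"
    then obtain j where j: "j < d" "z = \<theta> ^ (q ^ j)" by auto
    have "poly (map_poly \<iota> P) z = 0"
      using root q_gt_1 by (simp add: j poly_map_frobenius ev_def)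
    moreover have "poly ([:- \<theta>, 1:] * G) z = 0"
      using poly_G_conjugate[of j] j by simp
    ultimately show "poly ([:- \<theta>, 1:] * G) z = poly (Polynomial.smult ?c (map_poly \<iota> P)) z" by simp
  qed (fact deg)
qed

section \<open>The derivative of F_d at \<theta>\<close>

lemma ev_pderiv_F_prod: "ev (pderiv (F_prod d)) = - poly (pderiv G) \<theta>"
proof -
  let ?S = "{f :: 'a poly. f \<noteq> 0 \<and> degree f < d}"
  have fin: "finite ?S" by (rule finite_subset[OF _ finite_poly_degree_less[of d]]) auto
  \<comment> \<open>The other factors multiply to F_d(\<theta>) / f(\<theta>) = -1 / f(\<theta>),
    and the power \<open>q ^ d - 2\<close> is the inverse.\<close>
  have *: "ev (\<Prod>(?S - {f})) = - (ev f ^ (q ^ d - 2))" if "f \<in> ?S" for f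
  proof -
    have nz: "ev f \<noteq> 0" using bij_betwE[OF bij_betw_ev] that by auto
    have "ev f * ev (\<Prod>(?S - {f})) = -1"
      using ev_F_prod prod.remove[OF fin that, of "\<lambda>x. x"] by (simp add: F_prod_def ev.hom_mult)
    moreover have "Suc (q ^ d - 2) = CARD('b) - 1"
      using card_finite_field_gt_1[where 'a = 'b] by (simp add: card_b)
    hence "ev f * ev f ^ (q ^ d - 2) = 1"
      using finite_field_power_card_minus_1[OF nz] by (metis power_Suc)
    ultimately have "ev f * ev (\<Prod>(?S - {f})) = ev f * (- (ev f ^ (q ^ d - 2)))" by simp
    thus ?thesis by (rule mult_left_cancel[OF nz, THEN iffD1])
  qed
  have "ev (pderiv (F_prod d)) = (\<Sum>f\<in>?S. ev (\<Prod>(?S - {f})) * ev (pderiv f))"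
    unfolding F_prod_def by (simp add: pderiv_prod ev.hom_sum ev.hom_mult)
  also have "\<dots> = (\<Sum>f\<in>?S. - (ev f ^ (q ^ d - 2)) * ev (pderiv f))"
    by (intro sum.cong refl) (simp only: *)
  also have "\<dots> = - poly (pderiv G) \<theta>"
    by (simp add: G_def pderiv_sum pderiv_smult poly_sum ev_def map_poly_pderiv sum_negf)
  finally show ?thesis .
qed

lemma ev_pderiv_F_prod_eq_0_iff: "ev (pderiv (F_prod d)) = 0 \<longleftrightarrow> ev (pderiv (pderiv P)) = 0"
proof -
  obtain c where c: "[:- \<theta>, 1:] * G = Polynomial.smult c (map_poly \<iota> P)" using G_mult by blast
  have "poly (pderiv ([:- \<theta>, 1:] * G)) \<theta> = poly G \<theta>"
    by (simp add: pderiv_mult pderiv_pCons del: mult_pCons_left)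
  also have "\<dots> = -1" using poly_G_conjugate[of 0] d_pos by simp
  \<comment> \<open>The first derivative at \<theta> reads c P'(\<theta>) = G(\<theta>) =
    -1.\<close>
  finally have "c \<noteq> 0" unfolding c by (auto simp: pderiv_smult)
  have "poly (pderiv (pderiv ([:- \<theta>, 1:] * G))) \<theta> = 2 * poly (pderiv G) \<theta>"
    by (simp add: pderiv_mult pderiv_add pderiv_pCons del: mult_pCons_left)
  hence "2 * poly (pderiv G) \<theta> = c * ev (pderiv (pderiv P))"
    unfolding c by (simp add: pderiv_smult ev_def map_poly_pderiv)
  thus ?thesis using \<open>c \<noteq> 0\<close> two_neq_0
    by (metis ev_pderiv_F_prod mult_eq_0_iff neg_equal_0_iff_equal)
qed

lemma wilson_iff: "[F_prod d = -1] (mod P ^ 2) \<longleftrightarrow> ev (pderiv (pderiv P)) = 0"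
proof -
  have "[F_prod d = -1] (mod P ^ 2) \<longleftrightarrow> P ^ 2 dvd F_prod d + 1"
    by (simp add: cong_iff_dvd_diff)
  also have "\<dots> \<longleftrightarrow> ev (pderiv (pderiv P)) = 0"
    by (simp add: P_square_dvd_iff ev.hom_add ev_F_prod pderiv_add ev_pderiv_F_prod_eq_0_iff)
  finally show ?thesis .
qed

text \<open>Divisibility between polynomials over \<open>'a\<close> is unchanged by extending
  scalars along \<iota>.\<close>

lemma map_poly_cong_0_iff: "[map_poly \<iota> f = 0] (mod map_poly \<iota> P) \<longleftrightarrow> ev f = 0"
  by (auto simp: cong_0_iff ev_eq_0_iff intro: dvd_map_poly_hom_imp_dvd mp.hom_dvd)

text \<open>The second derivative has degree below \<open>d\<close>, so \<open>P\<close> can divide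
  it only if it is 0.\<close>

lemma pderiv2_eq_0_iff: "pderiv (pderiv P) = 0 \<longleftrightarrow> ev (pderiv (pderiv P)) = 0"
proof
  assume "ev (pderiv (pderiv P)) = 0"
  hence "P dvd pderiv (pderiv P)" by (simp add: ev_eq_0_iff)
  moreover have "degree (pderiv (pderiv P)) < degree P"
    using d_pos deg_P degree_pderiv_le[of P] degree_pderiv_le[of "pderiv P"] by linarith
  ultimately show "pderiv (pderiv P) = 0"
    using dvd_imp_degree_le linorder_not_less by blast
qed simp

end

theorem theorem3:
  fixes \<iota> :: "'a::finite_field \<Rightarrow> 'b::finite_field"
    and P :: "'a poly" and \<theta> :: 'b and p q d n :: nat
  assumes "prime p" and "odd p" and "q = p ^ n"
    and "CARD('a) = q" and "CARD('b) = q ^ d" and "field_hom \<iota>"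
    and "irreducible P" and "lead_coeff P = 1" and "degree P = d"
    and "poly (map_poly \<iota> P) \<theta> = 0"
  shows
    "([F_prod d = - 1] (mod P ^ 2) \<longleftrightarrow>
        pderiv (pderiv P) = 0) \<and>
     ([F_prod d = - 1] (mod P ^ 2) \<longleftrightarrow>
        [map_poly \<iota> (pderiv (pderiv P)) = 0] (mod map_poly \<iota> P)) \<and>
     ([F_prod d = - 1] (mod P ^ 2) \<longleftrightarrow>
        poly (map_poly \<iota> (pderiv (pderiv P))) \<theta> = 0) \<and>
     ([F_prod d = - 1] (mod P ^ 2) \<longleftrightarrow>
        [fermat_quotient q (map_poly \<iota> P) (fermat_quotient q (map_poly \<iota> P) [:0, 1:]) = 0]
          (mod map_poly \<iota> P)) \<and>
     ([F_prod d = - 1] (mod P ^ 2) \<longleftrightarrow>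
        poly (fermat_quotient q (map_poly \<iota> P) (fermat_quotient q (map_poly \<iota> P) [:0, 1:])) \<theta> = 0) \<and>
     ([F_prod d = - 1] (mod P ^ 2) \<longleftrightarrow>
        poly (diff_quotient \<theta> (map_poly \<iota> P) 2) \<theta> = 0)"
proof -
  interpret residue_field_embedding \<iota> P \<theta> p q d n
    using assms by (simp add: residue_field_embedding_def residue_field_embedding_axioms_def)
  \<comment> \<open>The polynomial t comes from \<open>'a\<close>, so both Fermat quotients descend
    there.\<close>
  have X: "[:0, 1:] = map_poly \<iota> [:0, 1:]" by (simp add: hom_distribs)
  have Q: "fermat_quotient q (map_poly \<iota> P) (fermat_quotient q (map_poly \<iota> P) [:0, 1:])
      = map_poly \<iota> (fermat_quotient q P (fermat_quotient q P [:0, 1:]))"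
    unfolding X fermat_quotient_map_poly ..
  have D: "poly (diff_quotient \<theta> (map_poly \<iota> P) 2) \<theta> = 0 \<longleftrightarrow> ev (pderiv (pderiv P)) = 0"
    using poly_pderiv2_eq_diff_quotient[of "map_poly \<iota> P" \<theta>] two_neq_0
    by (simp add: ev_def map_poly_pderiv)
  show ?thesis
    unfolding wilson_iff Q D map_poly_cong_0_iff ev_def[symmetric]
      ev_fermat_quotient_twice_eq_0_iff pderiv2_eq_0_iff
    by blast
qed

end
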